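(* Up to equivalence, there are exactly three classical valuations on the semifield $\mathbb{Q}_{max}$, exactly two strict valuations on $\mathbb{Q}_{max}$, and exactly two hyperfield valuations on $\mathbb{Q}_{max}$.
   Context: All semirings are commutative: a semiring $(S,+,\cdot)$ is a set with a commutative monoid structure $(S,+)$ with neutral element $0_S$ and a commutative monoid structure $(S,\cdot)$ with identity $1_S$, such that multiplication distributes over addition, $0_S$ is absorbing for multiplication, and $0_S\neq 1_S$. A semifield is a semiring in which every nonzero element is multiplicatively invertible. $\mathbb{R}_{max}$ is the semifield with underlying set $\mathbb{R}\cup\{-\infty\}$, addition $a\oplus b=\max\{a,b\}$, and multiplication $a\odot b=a+b$ (usual addition, with $-\infty$ absorbing); its zero is $-\infty$ and its multiplicative identity is the real number $0$. $\mathbb{Q}_{max}$ is its subsemifield with underlying set $\mathbb{Q}\cup\{-\infty\}$. Tropical hyperfield $\mathbb{T}$: underlying set $\mathbb{R}\cup\{-\infty\}$; multivalued addition $x\boxplus y=\{\max\{x,y\}\}$ if $x\neq y$, and $x\boxplus x=[-\infty,x]$; multiplication is usual addition of real numbers, with $-\infty$ absorbing. Let $S$ be a semiring and let $\nu:S\to\mathbb{R}\cup\{-\infty\}$ be a function with $\nu(0_S)=-\infty$, $\nu(xy)=\nu(x)+\nu(y)$ for all $x,y\in S$, and $\nu(S)\neq\{-\infty\}$. Then $\nu$ is: - a classical valuation if $\nu(x+y)\le\max\{\nu(x),\nu(y)\}$ for all $x,y\in S$; - a strict valuation if $\nu(x+y)=\max\{\nu(x),\nu(y)\}$ for all $x,y\in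 S$; - a hyperfield valuation if $\nu(x+y)\in\nu(x)\boxplus\nu(y)$ (hyperaddition of $\mathbb{T}$) for all $x,y\in S$. Two valuations $\nu_1,\nu_2$ of the same type on $S$ are equivalent if there is a real number $\rho>0$ with $\nu_1(x)=\rho\,\nu_2(x)$ for all $x\in S$ (where $\rho\cdot(-\infty)=-\infty$). The trivial valuation ($\nu(x)=0$ for all $x\ne 0_S$) is counted as a valuation. *)

theory Defs
  imports "HOL-Library.Extended_Real"
begin

text \<open>The class \<^class>\<open>comm_semiring_1\<close> is exactly the notion of (commutative) semiring
  with absorbing zero and \<open>0 \<noteq> 1\<close>.\<close>

class semifield = comm_semiring_1 +
  assumes nonzero_invertible: "x \<noteq> 0 \<Longrightarrow> \<exists>y. x * y = 1"


text \<open>The max-plus semifields. Beware that the zero of \<open>rmax\<close> is \<open>-\<infinity>\<close> and its one is the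
  real number \<open>0\<close>.\<close>

typedef rmax = "{x :: ereal. x \<noteq> \<infinity>}"
  by (rule exI[of _ 0]) simp

setup_lifting type_definition_rmax

instantiation rmax :: semifield
begin

lift_definition zero_rmax :: rmax is "-\<infinity> :: ereal" by simp
lift_definition one_rmax :: rmax is "0 :: ereal" by simp
lift_definition plus_rmax :: "rmax \<Rightarrow> rmax \<Rightarrow> rmax" is "\<lambda>x y. max x y"
  by (auto simp: max_def)
lift_definition times_rmax :: "rmax \<Rightarrow> rmax \<Rightarrow> rmax" is "\<lambda>x y. x + y"
  by auto

instance
proof
  fix a b c :: rmax
  show "a + b + c = a + (b + c)" by transfer (simp add: max.assoc)
  show "a + b = b + a" by transfer (simp add: max.commute)
  show "0 + a = a" by transfer (simp add: max_def)
  show "a * b * c = a * (b * c)" by transfer (simp add: add.assoc)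
  show "a * b = b * a" by transfer (simp add: add.commute)
  show "1 * a = a" by transfer simp
  show "(a + b) * c = a * c + b * c"
    by transfer (auto simp: max_def add_right_mono intro: antisym)
  show "0 * a = 0" by transfer simp
  show "a * 0 = 0" by transfer simp
  show "(0 :: rmax) \<noteq> 1" by transfer simp
  show "a \<noteq> 0 \<Longrightarrow> \<exists>y. a * y = 1"
  proof transfer
    fix x :: ereal
    assume "x \<noteq> \<infinity>" "x \<noteq> -\<infinity>"
    then show "\<exists>y\<in>{x. x \<noteq> \<infinity>}. x + y = 0"
      by (intro bexI[of _ "- x"]; cases x) auto
  qed
qed

end

typedef qmax = "{x :: rmax. Rep_rmax x = -\<infinity> \<or> (\<exists>q :: rat. Rep_rmax x = ereal (of_rat q))}"
  by (rule exI[of _ 0]) (simp add: zero_rmax.rep_eq)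

setup_lifting type_definition_qmax

instantiation qmax :: semifield
begin

lift_definition zero_qmax :: qmax is "0 :: rmax"
  by (simp add: zero_rmax.rep_eq)
lift_definition one_qmax :: qmax is "1 :: rmax"
  by (auto simp: one_rmax.rep_eq zero_ereal_def intro: exI[of _ 0])
lift_definition plus_qmax :: "qmax \<Rightarrow> qmax \<Rightarrow> qmax" is "\<lambda>x y. x + y"
  by (auto simp: plus_rmax.rep_eq max_def)
lift_definition times_qmax :: "qmax \<Rightarrow> qmax \<Rightarrow> qmax" is "\<lambda>x y. x * y"
  by (auto simp: times_rmax.rep_eq of_rat_add [symmetric])

instance
proof
  fix a b c :: qmax
  show "a + b + c = a + (b + c)" by transfer (simp add: add.assoc)
  show "a + b = b + a" by transfer (simp add: add.commute)
  show "0 + a = a" by transfer simp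
  show "a * b * c = a * (b * c)" by transfer (simp add: mult.assoc)
  show "a * b = b * a" by transfer (simp add: mult.commute)
  show "1 * a = a" by transfer simp
  show "(a + b) * c = a * c + b * c" by transfer (simp add: distrib_right)
  show "0 * a = 0" by transfer simp
  show "a * 0 = 0" by transfer simp
  show "(0 :: qmax) \<noteq> 1" by transfer simp
  show "a \<noteq> 0 \<Longrightarrow> \<exists>y. a * y = 1"
  proof transfer
    fix x :: rmax
    assume x: "Rep_rmax x = -\<infinity> \<or> (\<exists>q::rat. Rep_rmax x = ereal (of_rat q))" "x \<noteq> 0"
    then obtain q :: rat where q: "Rep_rmax x = ereal (of_rat q)"
      by (auto simp: zero_rmax.rep_eq Rep_rmax_inject [symmetric])
    define y where "y = Abs_rmax (ereal (of_rat (- q)))"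
    have y: "Rep_rmax y = ereal (of_rat (- q))"
      by (simp add: y_def Abs_rmax_inverse)
    have "x * y = 1"
      using q y by (simp add: Rep_rmax_inject [symmetric] times_rmax.rep_eq one_rmax.rep_eq
          of_rat_minus zero_ereal_def)
    then show "\<exists>y\<in>{x. Rep_rmax x = -\<infinity> \<or> (\<exists>q::rat. Rep_rmax x = ereal (of_rat q))}. x * y = 1"
      using y by blast
  qed
qed

end


text \<open>Hyperaddition of the tropical hyperfield, whose underlying set is \<open>{x :: ereal. x \<noteq> \<infinity>}\<close>.\<close>

definition trop_hyperadd :: "ereal \<Rightarrow> ereal \<Rightarrow> ereal set" where
  "trop_hyperadd x y = (if x = y then {-\<infinity>..x} else {max x y})"


text \<open>Valuations take values in the extended reals and avoid \<open>\<infinity>\<close>.\<close>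

definition pre_valuation :: "('a::comm_semiring_1 \<Rightarrow> ereal) \<Rightarrow> bool" where
  "pre_valuation \<nu> \<longleftrightarrow> (\<forall>x. \<nu> x \<noteq> \<infinity>) \<and> \<nu> 0 = -\<infinity> \<and> (\<forall>x y. \<nu> (x * y) = \<nu> x + \<nu> y)
     \<and> range \<nu> \<noteq> {-\<infinity>}"

definition classical_valuation :: "('a::comm_semiring_1 \<Rightarrow> ereal) \<Rightarrow> bool" where
  "classical_valuation \<nu> \<longleftrightarrow> pre_valuation \<nu> \<and> (\<forall>x y. \<nu> (x + y) \<le> max (\<nu> x) (\<nu> y))"

definition strict_valuation :: "('a::comm_semiring_1 \<Rightarrow> ereal) \<Rightarrow> bool" where
  "strict_valuation \<nu> \<longleftrightarrow> pre_valuation \<nu> \<and> (\<forall>x y. \<nu> (x + y) = max (\<nu> x) (\<nu> y))"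

definition hyperfield_valuation :: "('a::comm_semiring_1 \<Rightarrow> ereal) \<Rightarrow> bool" where
  "hyperfield_valuation \<nu> \<longleftrightarrow> pre_valuation \<nu> \<and> (\<forall>x y. \<nu> (x + y) \<in> trop_hyperadd (\<nu> x) (\<nu> y))"


text \<open>Equivalence of valuations within a given type of valuations, i.e. a set \<open>V\<close>. In
  \<^typ>\<open>ereal\<close>, \<open>\<rho> * (-\<infinity>) = -\<infinity>\<close> for real \<open>\<rho> > 0\<close>.\<close>

definition valuation_equiv :: "('a \<Rightarrow> ereal) set \<Rightarrow> (('a \<Rightarrow> ereal) \<times> ('a \<Rightarrow> ereal)) set" where
  "valuation_equiv V =
     {(\<nu>\<^sub>1, \<nu>\<^sub>2). \<nu>\<^sub>1 \<in> V \<and> \<nu>\<^sub>2 \<in> V \<and> (\<exists>\<rho>::real. \<rho> > 0 \<and> (\<forall>x. \<nu>\<^sub>1 x = ereal \<rho> * \<nu>\<^sub>2 x))}"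

lemma equiv_valuation_equiv: "equiv V (valuation_equiv V)"
proof (rule equivI)
  show "valuation_equiv V \<subseteq> V \<times> V"
    by (auto simp: valuation_equiv_def)
  show "refl_on V (valuation_equiv V)"
    by (auto simp: refl_on_def valuation_equiv_def one_ereal_def [symmetric] intro!: exI[of _ 1])
  show "sym (valuation_equiv V)"
  proof (rule symI)
    fix \<mu> \<nu> assume "(\<mu>, \<nu>) \<in> valuation_equiv V"
    then obtain \<rho> :: real where *: "\<mu> \<in> V" "\<nu> \<in> V" "\<rho> > 0" "\<And>x. \<mu> x = ereal \<rho> * \<nu> x"
      by (auto simp: valuation_equiv_def)
    have "\<nu> x = ereal (1 / \<rho>) * \<mu> x" for x
      using * by (simp add: mult.assoc [symmetric] one_ereal_def [symmetric])
    with * show "(\<nu>, \<mu>) \<in> valuation_equiv V"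
      by (auto simp: valuation_equiv_def intro!: exI[of _ "1 / \<rho>"])
  qed
  show "trans (valuation_equiv V)"
  proof (rule transI)
    fix \<mu> \<nu> \<xi> assume "(\<mu>, \<nu>) \<in> valuation_equiv V" "(\<nu>, \<xi>) \<in> valuation_equiv V"
    then obtain \<rho> \<sigma> :: real where *: "\<mu> \<in> V" "\<xi> \<in> V" "\<rho> > 0" "\<sigma> > 0"
        "\<And>x. \<mu> x = ereal \<rho> * \<nu> x" "\<And>x. \<nu> x = ereal \<sigma> * \<xi> x"
      by (auto simp: valuation_equiv_def)
    have "\<mu> x = ereal (\<rho> * \<sigma>) * \<xi> x" for x
      using * by (simp add: mult.assoc [symmetric])
    with * show "(\<mu>, \<xi>) \<in> valuation_equiv V"
      by (auto simp: valuation_equiv_def intro!: exI[of _ "\<rho> * \<sigma>"])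
  qed
qed

definition valuation_classes :: "('a \<Rightarrow> ereal) set \<Rightarrow> ('a \<Rightarrow> ereal) set set" where
  "valuation_classes V = V // valuation_equiv V"

end

theory Submission
  imports Defs
begin

text \<open>The unit group of \<^typ>\<open>qmax\<close> is the additive group of the rationals, so a valuation is the
  same thing as an additive map from the rationals to the reals, i.e. multiplication by a real
  number \<open>c\<close>, and scaling a valuation scales \<open>c\<close>: the equivalence class is the sign of \<open>c\<close>.
  Since \<open>x + y\<close> is \<open>x\<close> or \<open>y\<close>, the classical condition always holds, whereas the other two
  conditions hold precisely if \<open>c \<ge> 0\<close>.\<close>

lift_definition rmax_of_rat :: "rat \<Rightarrow> rmax" is "\<lambda>q. ereal (of_rat q)" by simp

text \<open>This is the isomorphism from the additive group of the rationals onto the unit group of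
  \<open>qmax\<close>.\<close>

lift_definition qmax_of_rat :: "rat \<Rightarrow> qmax" is rmax_of_rat
  by (auto simp: rmax_of_rat.rep_eq)

lemma rmax_of_rat_add: "rmax_of_rat (p + q) = rmax_of_rat p * rmax_of_rat q"
  by transfer (simp add: of_rat_add)

lemma qmax_of_rat_add: "qmax_of_rat (p + q) = qmax_of_rat p * qmax_of_rat q"
  by transfer (rule rmax_of_rat_add)

lemma rmax_of_rat_max: "rmax_of_rat p + rmax_of_rat q = rmax_of_rat (max p q)"
  by transfer (auto simp: max_def of_rat_less_eq)

lemma qmax_of_rat_max: "qmax_of_rat p + qmax_of_rat q = qmax_of_rat (max p q)"
  by transfer (rule rmax_of_rat_max)

lemma rmax_of_rat_neq_0: "rmax_of_rat q \<noteq> 0"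
  by transfer simp

lemma qmax_of_rat_neq_0 [simp]: "qmax_of_rat q \<noteq> 0"
  by transfer (rule rmax_of_rat_neq_0)

lemma rmax_of_rat_0: "rmax_of_rat 0 = 1"
  by transfer (simp add: zero_ereal_def)

lemma qmax_of_rat_0: "qmax_of_rat 0 = 1"
  by transfer (rule rmax_of_rat_0)

lemma qmax_cases [case_names zero of_rat]:
  obtains "x = 0" | q where "x = qmax_of_rat q"
proof -
  have "x = 0 \<or> (\<exists>q. x = qmax_of_rat q)"
    by transfer
      (auto simp: Rep_rmax_inject [symmetric] zero_rmax.rep_eq rmax_of_rat.rep_eq)
  with that show thesis by blast
qed

text \<open>Additivity gives homogeneity over the naturals, then over the integers; clearing the
  denominator of \<open>q\<close> extends it to the rationals.\<close>

lemma rational_additive_linear: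
  fixes f :: "rat \<Rightarrow> real"
  assumes add: "\<And>p q. f (p + q) = f p + f q"
  shows "f q = f 1 * of_rat q"
proof -
  have f0: "f 0 = 0"
    using add[of 0 0] by simp
  have nat: "f (of_nat n * p) = of_nat n * f p" for n p
    by (induction n) (simp_all add: f0 add distrib_right)
  have minus: "f (- p) = - f p" for p
    using add[of p "- p"] by (simp add: f0)
  have int: "f (of_int k * p) = of_int k * f p" for k p
    \<comment> \<open>The negative case is \<open>- int (Suc n)\<close>; keeping
      \<open>of_nat (Suc n)\<close> folded lets \<open>nat\<close> match it.\<close>
    by (cases k) (simp_all add: nat minus del: of_nat_Suc)
  obtain a b :: int where q: "q = Fract a b" and b: "b > 0"
    by (cases q) auto
  \<comment> \<open>Since \<open>b * q = a\<close>, both sides are values of \<open>f\<close> at the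
    same point. The factor \<open>1\<close> makes \<open>int\<close> produce
    \<open>f 1\<close>.\<close>
  have "of_int b * f q = f (of_int a * 1)"
    using b by (simp add: int [symmetric] q Fract_of_int_quotient)
  then show ?thesis
    using b unfolding int by (simp add: q of_rat_rat field_simps)
qed

text \<open>The case distinction is needed because multiplying \<open>-\<infinity>\<close> by \<open>c \<le> 0\<close> does not give \<open>-\<infinity>\<close>.\<close>

definition linear_valuation :: "real \<Rightarrow> qmax \<Rightarrow> ereal" where
  "linear_valuation c x = (if x = 0 then -\<infinity> else ereal c * Rep_rmax (Rep_qmax x))"

lemma linear_valuation_0 [simp]: "linear_valuation c 0 = -\<infinity>"
  by (simp add: linear_valuation_def)

lemma linear_valuation_of_rat [simp]:
  "linear_valuation c (qmax_of_rat q) = ereal (c * of_rat q)"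
  by (simp add: linear_valuation_def qmax_of_rat.rep_eq rmax_of_rat.rep_eq)

lemma linear_valuation_eq_iff [simp]:
  "linear_valuation c = linear_valuation d \<longleftrightarrow> c = d"
proof
  assume "linear_valuation c = linear_valuation d"
  then have "linear_valuation c (qmax_of_rat 1) = linear_valuation d (qmax_of_rat 1)"
    by (rule fun_cong)
  then show "c = d" by simp
qed simp

lemma pre_valuation_linear_valuation: "pre_valuation (linear_valuation c)"
proof -
  have "linear_valuation c x \<noteq> \<infinity>" for x
    by (cases x rule: qmax_cases) simp_all
  moreover have "linear_valuation c (x * y) = linear_valuation c x + linear_valuation c y" for x y
    by (cases x rule: qmax_cases; cases y rule: qmax_cases)
      (simp_all add: qmax_of_rat_add [symmetric] of_rat_add distrib_left)
  moreover have "range (linear_valuation c) \<noteq> {-\<infinity>}"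
  proof
    assume "range (linear_valuation c) = {-\<infinity>}"
    then have "linear_valuation c (qmax_of_rat 0) = -\<infinity>" by blast
    then show False by simp
  qed
  ultimately show ?thesis
    by (simp add: pre_valuation_def)
qed

lemma pre_valuation_qmax_eq_linear_valuation:
  fixes \<nu> :: "qmax \<Rightarrow> ereal"
  assumes "pre_valuation \<nu>"
  obtains c where "\<nu> = linear_valuation c"
proof -
  have not_inf: "\<nu> x \<noteq> \<infinity>" and zero: "\<nu> 0 = -\<infinity>" and mult: "\<nu> (x * y) = \<nu> x + \<nu> y"
    and range: "range \<nu> \<noteq> {-\<infinity>}" for x y
    using assms by (auto simp: pre_valuation_def)
  obtain y where y: "\<nu> y \<noteq> -\<infinity>"
    using range by fastforce
  \<comment> \<open>From \<open>\<nu> y = \<nu> 1 + \<nu> y\<close>, the value -\<infinity> at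
    \<open>1\<close> would spread to \<open>y\<close>.\<close>
  have one: "\<nu> 1 \<noteq> -\<infinity>"
    using mult[of 1 y] y not_inf[of y] by (cases "\<nu> y") auto
  have finite: "\<nu> (qmax_of_rat q) \<noteq> -\<infinity>" for q
  proof
    assume "\<nu> (qmax_of_rat q) = -\<infinity>"
    \<comment> \<open>The inverse of \<open>qmax_of_rat q\<close> is
      \<open>qmax_of_rat (- q)\<close>, so the value -\<infinity> would pass on to \<open>1\<close>.
      The sum stays -\<infinity> because the other summand is not \<infinity>.\<close>
    then have "\<nu> (qmax_of_rat (q + - q)) = -\<infinity>"
      unfolding qmax_of_rat_add mult using not_inf by auto
    with one show False
      by (simp add: qmax_of_rat_0)
  qed
  define f where "f q = real_of_ereal (\<nu> (qmax_of_rat q))" for q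
  have f: "\<nu> (qmax_of_rat q) = ereal (f q)" for q
    using finite[of q] not_inf[of "qmax_of_rat q"] by (auto simp: f_def ereal_real)
  have "f (p + q) = f p + f q" for p q
    using mult[of "qmax_of_rat p" "qmax_of_rat q"] by (simp add: f qmax_of_rat_add [symmetric])
  then have linear: "f q = f 1 * of_rat q" for q
    by (rule rational_additive_linear)
  have "\<nu> x = linear_valuation (f 1) x" for x
  proof (cases x rule: qmax_cases)
    case zero
    then show ?thesis by (simp add: \<open>\<nu> 0 = -\<infinity>\<close>)
  next
    case (of_rat q)
    then show ?thesis using linear[of q] by (simp add: f)
  qed
  then show thesis using that by blast
qed

text \<open>Addition of rational elements is \<open>max\<close>, and multiplication by a nonnegative
  \<open>c\<close> is monotone, so it commutes with \<open>max\<close>.\<close>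

lemma linear_valuation_add:
  assumes "c \<ge> 0"
  shows "linear_valuation c (x + y) = max (linear_valuation c x) (linear_valuation c y)"
  using assms
  by (cases x rule: qmax_cases; cases y rule: qmax_cases)
    (auto simp: qmax_of_rat_max max_def of_rat_less_eq mult_le_cancel_left)

lemma linear_valuation_add_le:
  "linear_valuation c (x + y) \<le> max (linear_valuation c x) (linear_valuation c y)"
  by (cases x rule: qmax_cases; cases y rule: qmax_cases)
    (auto simp: qmax_of_rat_max max_def)

lemma classical_valuations_qmax:
  "{\<nu> :: qmax \<Rightarrow> ereal. classical_valuation \<nu>} = range linear_valuation"
proof (intro equalityI subsetI)
  fix \<nu> :: "qmax \<Rightarrow> ereal"
  assume "\<nu> \<in> {\<nu>. classical_valuation \<nu>}"
  then show "\<nu> \<in> range linear_valuation"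
    by (auto simp: classical_valuation_def elim: pre_valuation_qmax_eq_linear_valuation)
qed (auto simp: classical_valuation_def pre_valuation_linear_valuation linear_valuation_add_le)

lemma strict_valuations_qmax:
  "{\<nu> :: qmax \<Rightarrow> ereal. strict_valuation \<nu>} = linear_valuation ` {0..}"
proof (intro equalityI subsetI)
  fix \<nu> :: "qmax \<Rightarrow> ereal"
  assume "\<nu> \<in> {\<nu>. strict_valuation \<nu>}"
  then obtain c where c: "\<nu> = linear_valuation c"
    and add: "\<nu> (x + y) = max (\<nu> x) (\<nu> y)" for x y
    unfolding strict_valuation_def mem_Collect_eq
    by (metis pre_valuation_qmax_eq_linear_valuation)
  \<comment> \<open>The semiring sum of the rationals 0 and 1 is 1, so the condition reads
    \<open>c = max 0 c\<close>.\<close>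
  have "c \<ge> 0"
    using add[of "qmax_of_rat 0" "qmax_of_rat 1"]
    by (simp add: c qmax_of_rat_max max_def zero_ereal_def split: if_splits)
  with c show "\<nu> \<in> linear_valuation ` {0..}"
    by simp
qed (auto simp: strict_valuation_def pre_valuation_linear_valuation linear_valuation_add)

text \<open>The maximum always lies in the hypersum: for equal values it is the upper end of the
  interval.\<close>

lemma strict_imp_hyperfield_valuation: "strict_valuation \<nu> \<Longrightarrow> hyperfield_valuation \<nu>"
  by (auto simp: strict_valuation_def hyperfield_valuation_def trop_hyperadd_def)

lemma hyperfield_valuations_qmax:
  "{\<nu> :: qmax \<Rightarrow> ereal. hyperfield_valuation \<nu>} = linear_valuation ` {0..}"
proof (intro equalityI subsetI)
  fix \<nu> :: "qmax \<Rightarrow> ereal"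
  assume "\<nu> \<in> {\<nu>. hyperfield_valuation \<nu>}"
  then obtain c where c: "\<nu> = linear_valuation c"
    and add: "\<nu> (x + y) \<in> trop_hyperadd (\<nu> x) (\<nu> y)" for x y
    unfolding hyperfield_valuation_def mem_Collect_eq
    by (metis pre_valuation_qmax_eq_linear_valuation)
  \<comment> \<open>For nonzero \<open>c\<close> the values 0 and \<open>c\<close> differ, so their
    hypersum is a singleton and again \<open>c = max 0 c\<close>.\<close>
  have "c \<ge> 0"
    using add[of "qmax_of_rat 0" "qmax_of_rat 1"]
    by (simp add: c qmax_of_rat_max trop_hyperadd_def max_def zero_ereal_def split: if_splits)
  with c show "\<nu> \<in> linear_valuation ` {0..}"
    by simp
next
  fix \<nu> :: "qmax \<Rightarrow> ereal"
  assume "\<nu> \<in> linear_valuation ` {0..}"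
  then show "\<nu> \<in> {\<nu>. hyperfield_valuation \<nu>}"
    using strict_valuations_qmax strict_imp_hyperfield_valuation by blast
qed

text \<open>The value at the rational 1 recovers the slope. Conversely, \<open>\<rho> > 0\<close>
  makes scaling preserve the value -\<infinity> at zero.\<close>

lemma linear_valuation_scale_iff:
  assumes "\<rho> > 0"
  shows "(\<forall>x. linear_valuation c x = ereal \<rho> * linear_valuation d x) \<longleftrightarrow> c = \<rho> * d"
proof
  assume "\<forall>x. linear_valuation c x = ereal \<rho> * linear_valuation d x"
  from this[rule_format, of "qmax_of_rat 1"] show "c = \<rho> * d"
    by simp
next
  assume c: "c = \<rho> * d"
  show "\<forall>x. linear_valuation c x = ereal \<rho> * linear_valuation d x"
  proof
    fix x
    show "linear_valuation c x = ereal \<rho> * linear_valuation d x"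
      using assms by (cases x rule: qmax_cases) (simp_all add: c)
  qed
qed

text \<open>For nonzero \<open>d\<close> the only candidate for \<open>\<rho>\<close> is
  \<open>c / d\<close>, which is positive exactly when the signs agree.\<close>

lemma sgn_eq_iff_positive_multiple:
  fixes c d :: real
  shows "sgn c = sgn d \<longleftrightarrow> (\<exists>\<rho>>0. c = \<rho> * d)"
proof
  assume sgn: "sgn c = sgn d"
  show "\<exists>\<rho>>0. c = \<rho> * d"
  proof (cases "d = 0")
    case True
    with sgn show ?thesis by (auto simp: sgn_0_0 intro: exI[of _ 1])
  next
    case False
    with sgn have "c / d > 0"
      by (auto simp: sgn_if zero_less_divide_iff split: if_splits)
    with False show ?thesis by (intro exI[of _ "c / d"]) simp
  qed
qed (auto simp: sgn_mult)

lemma valuation_equiv_linear_valuation_iff: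
  "(linear_valuation c, linear_valuation d) \<in> valuation_equiv (linear_valuation ` C) \<longleftrightarrow>
     c \<in> C \<and> d \<in> C \<and> sgn c = sgn d"
  \<comment> \<open>The congruence rule makes \<open>\<rho> > 0\<close> available to the conditional
    rewrite \<open>linear_valuation_scale_iff\<close>.\<close>
  by (simp add: valuation_equiv_def sgn_eq_iff_positive_multiple image_iff
      linear_valuation_scale_iff cong: conj_cong)

text \<open>Each equivalence class is \<open>F s\<close> for a sign \<open>s\<close> occurring in
  \<open>C\<close>, so counting classes amounts to counting signs.\<close>

lemma card_valuation_classes_linear_valuation:
  "card (valuation_classes (linear_valuation ` C)) = card (sgn ` C)"
proof -
  define F where "F s = linear_valuation ` {c \<in> C. sgn c = s}" for s :: real
  have F: "valuation_equiv (linear_valuation ` C) `` {linear_valuation c} = F (sgn c)"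
    if "c \<in> C" for c
  proof (intro equalityI subsetI)
    fix \<nu> assume \<nu>: "\<nu> \<in> valuation_equiv (linear_valuation ` C) `` {linear_valuation c}"
    then obtain d where "d \<in> C" "\<nu> = linear_valuation d"
      by (auto simp: valuation_equiv_def)
    with \<nu> show "\<nu> \<in> F (sgn c)"
      by (auto simp: F_def valuation_equiv_linear_valuation_iff)
  qed (use that in \<open>auto simp: F_def valuation_equiv_linear_valuation_iff\<close>)
  have "valuation_classes (linear_valuation ` C) = F ` sgn ` C"
    using F by (auto simp: valuation_classes_def quotient_def)
  \<comment> \<open>For an occurring sign, \<open>F s\<close> has a member, and the slope of that
    member determines \<open>s\<close>.\<close>
  moreover have "inj_on F (sgn ` C)"
  proof (rule inj_onI)
    fix s t assume "s \<in> sgn ` C" "F s = F t"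
    then obtain c where "c \<in> C" "sgn c = s"
      by blast
    then have "linear_valuation c \<in> F s"
      by (simp add: F_def)
    with \<open>F s = F t\<close> have "linear_valuation c \<in> F t"
      by simp
    with \<open>sgn c = s\<close> show "s = t"
      by (auto simp: F_def)
  qed
  ultimately show ?thesis
    by (simp add: card_image)
qed

theorem theoremA:
  shows "card (valuation_classes {\<nu> :: qmax \<Rightarrow> ereal. classical_valuation \<nu>}) = 3
       \<and> card (valuation_classes {\<nu> :: qmax \<Rightarrow> ereal. strict_valuation \<nu>}) = 2
       \<and> card (valuation_classes {\<nu> :: qmax \<Rightarrow> ereal. hyperfield_valuation \<nu>}) = 2"
proof -
  \<comment> \<open>The \<open>rangeI\<close> instances witness that all three signs are
    attained.\<close>
  have "range sgn = {-1, 0, 1 :: real}"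
    using rangeI[of sgn "-1 :: real"] rangeI[of sgn "0 :: real"] rangeI[of sgn "1 :: real"]
    by (auto simp: sgn_if)
  moreover have "sgn ` {0..} = {0, 1 :: real}"
    using imageI[of "0 :: real" "{0..}" sgn] imageI[of "1 :: real" "{0..}" sgn]
    by (auto simp: sgn_if)
  ultimately show ?thesis
    by (simp add: classical_valuations_qmax strict_valuations_qmax hyperfield_valuations_qmax
        card_valuation_classes_linear_valuation)
qed

end
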